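(* In the setting of the convex problem $\inf_{x\in X} f(x)$ subject to $C(x)\in K$ described in the context, let $(x^k,y^k,\lambda^k,s^k)_{k}$ be a sequence generated by the inexact augmented Lagrangian method (IALM) with errors $(\varepsilon_k)_{k\ge1}$ and penalty parameters $(\gamma_k)_{k\ge0}$ satisfying the error and step-size conditions. If the value function $\nu$ is subdifferentiable at $\bar s$, then the algorithm converges quantitatively to the closest feasible problem.
   Context: Setting. $X$ is a nonempty closed convex subset of a real Hilbert space, $Y$ is a real Hilbert space, $K\subseteq Y$ is nonempty, closed and convex, $f:X\to\mathbb{R}\cup\{+\infty\}$ is closed (lower semicontinuous), proper and convex, and $C:X\to Y$ is a mapping such that $\mathcal{C}=\{(x,s)\in X\times Y: s\in C(x)-K\}$ is closed and convex. The problem may be infeasible. The value function is $\nu(s)=\inf\{f(x): x\in X,\ C(x)\in K+s\}$ for $s\in Y$ (a convex function); it is assumed throughout that $\nu(s)>-\infty$ for all $s$. "Subdifferentiable at $\bar s$" means $\nu(\bar s)<\infty$ and $\partial\nu(\bar s)\neq\emptyset$. The set of attainable constraint violations is $\mathcal{S}=\{s\in Y:\exists x\in X,\ f(x)<\infty,\ (x,s)\in\mathcal{C}\}$ (convex), and $\bar s=\operatorname{argmin}_{s\in\operatorname{cl}(\mathcal{S})}\|s\|$. The closest feasible problem is $\inf\{f(x):x\in X,\ C(x)\in K+\bar s\}$, with value $\nu(\bar s)$. $\operatorname{Proj}_K$ is the metric projection onto $K$. IALM. For $\gamma>0$ and $(x,s)\in\mathcal{C}$ let $L_\gamma(x,s,\lambda)=f(x)-\langle\lambda,s\rangle+\tfrac{\gamma}{2}\|s\|^2$.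 Given $\lambda^0\in Y$, $\gamma_k>0$, $\varepsilon_k\ge0$, for $k=0,1,2,\dots$: find $x^{k+1}\in X$, $y^{k+1}\in K$ such that, with $s^{k+1}=C(x^{k+1})-y^{k+1}$, $L_{\gamma_k}(x^{k+1},s^{k+1},\lambda^k)-\inf_{(x,s)\in\mathcal{C}}L_{\gamma_k}(x,s,\lambda^k)\le\frac{(\varepsilon_{k+1})^2}{2\gamma_k}$; set $\lambda^{k+1}=\lambda^k-\gamma_ks^{k+1}$. Error and step-size conditions: $\gamma_k>0$, $\varepsilon_k\ge 0$, and (A1) $\sum_{k=1}^\infty\varepsilon_k<\infty$; (A2) $\frac{\varepsilon_{k+1}}{\gamma_k}\sum_{i=0}^k\gamma_i=O\left(\frac{1}{\sqrt{\sum_{i=0}^k\gamma_i}}\right)$; (A3) $\sum_{k=1}^\infty\left((\varepsilon_k/\gamma_k)^2\sum_{i=0}^{k-1}\gamma_i\right)<\infty$; (A4) $\sum_{k=1}^\infty\left((\varepsilon_k/\gamma_k)\sum_{i=1}^{k}\gamma_{i-1}\right)<\infty$; (A5) $\sum_{k=0}^\infty\gamma_k=\infty$. Convergence notion. IALM quantitatively converges to the closest feasible problem when $f(x^k)\to\nu(\bar s)$, $C(x^k)-y^k\to\bar s$, $\|y^k-\operatorname{Proj}_K(C(x^k))\|\to0$, and moreover the three quantities $\|C(x^k)-y^k-\bar s\|$, $\|y^k-\operatorname{Proj}_K(C(x^k))\|$ and $|f(x^k)-\nu(\bar s)|$ are all $O\left(1/\sqrt{\sum_{i=0}^{k-1}\gamma_i}\right)$.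 *)

theory Defs
  imports "HOL-Analysis.Analysis"
begin

section \<open>Extended-real-valued functions\<close>

text \<open>
  A function with values in \<open>\<real> \<union> {+\<infinity>}\<close> is an \<^typ>\<open>ereal\<close>-valued function that avoids \<open>-\<infinity>\<close>
  on its domain \<open>X\<close>. Its values outside \<open>X\<close> are never used.
\<close>

definition proper_on :: "'a set \<Rightarrow> ('a \<Rightarrow> ereal) \<Rightarrow> bool" where
  "proper_on X f \<longleftrightarrow> (\<forall>x\<in>X. f x \<noteq> -\<infinity>) \<and> (\<exists>x\<in>X. f x < \<infinity>)"

definition lsc_on :: "'a::topological_space set \<Rightarrow> ('a \<Rightarrow> ereal) \<Rightarrow> bool" where
  "lsc_on X f \<longleftrightarrow> (\<forall>x\<in>X. f x \<le> Liminf (at x within X) f)"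

definition ereal_convex_on :: "'a::real_vector set \<Rightarrow> ('a \<Rightarrow> ereal) \<Rightarrow> bool" where
  "ereal_convex_on X f \<longleftrightarrow> convex X \<and>
    (\<forall>x\<in>X. \<forall>y\<in>X. \<forall>u\<ge>0. \<forall>v\<ge>0. u + v = 1 \<longrightarrow>
      f (u *\<^sub>R x + v *\<^sub>R y) \<le> ereal u * f x + ereal v * f y)"

definition subdifferential :: "('a::real_inner \<Rightarrow> ereal) \<Rightarrow> 'a \<Rightarrow> 'a set" where
  "subdifferential g s = {l. \<forall>t. g s + ereal (inner l (t - s)) \<le> g t}"

definition subdifferentiable_at :: "('a::real_inner \<Rightarrow> ereal) \<Rightarrow> 'a \<Rightarrow> bool" where
  "subdifferentiable_at g s \<longleftrightarrow> g s < \<infinity> \<and> subdifferential g s \<noteq> {}"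

text \<open>
  The library's \<open>closest_point\<close> requires a Heine--Borel space, which excludes
  infinite-dimensional Hilbert spaces.
\<close>

definition metric_proj :: "'a::real_normed_vector set \<Rightarrow> 'a \<Rightarrow> 'a" where
  "metric_proj K y = arg_min_on (\<lambda>p. norm (y - p)) K"


section \<open>The constrained problem\<close>

text \<open>The set \<open>{(x, s) \<in> X \<times> Y. s \<in> C x - K}\<close>.\<close>

definition constraint_graph ::
  "'a set \<Rightarrow> ('a \<Rightarrow> 'b::real_normed_vector) \<Rightarrow> 'b set \<Rightarrow> ('a \<times> 'b) set" where
  "constraint_graph X C K = {(x, s). x \<in> X \<and> s \<in> (\<lambda>y. C x - y) ` K}"

definition value_fun ::
  "'a set \<Rightarrow> ('a \<Rightarrow> ereal) \<Rightarrow> ('a \<Rightarrow> 'b::real_normed_vector) \<Rightarrow> 'b set \<Rightarrow> 'b \<Rightarrow> ereal" where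
  "value_fun X f C K s = (INF x\<in>{x \<in> X. C x \<in> s +o K}. f x)"

definition attainable_violations ::
  "'a set \<Rightarrow> ('a \<Rightarrow> ereal) \<Rightarrow> ('a \<Rightarrow> 'b::real_normed_vector) \<Rightarrow> 'b set \<Rightarrow> 'b set" where
  "attainable_violations X f C K =
    {s. \<exists>x\<in>X. f x < \<infinity> \<and> (x, s) \<in> constraint_graph X C K}"

definition min_violation ::
  "'a set \<Rightarrow> ('a \<Rightarrow> ereal) \<Rightarrow> ('a \<Rightarrow> 'b::real_normed_vector) \<Rightarrow> 'b set \<Rightarrow> 'b" where
  "min_violation X f C K = arg_min_on norm (closure (attainable_violations X f C K))"


section \<open>The inexact augmented Lagrangian method\<close>

definition aug_lagrangian ::
  "('a \<Rightarrow> ereal) \<Rightarrow> real \<Rightarrow> 'a \<Rightarrow> 'b::real_inner \<Rightarrow> 'b \<Rightarrow> ereal" where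
  "aug_lagrangian f g x s l = f x - ereal (inner l s) + ereal (g / 2 * (norm s)\<^sup>2)"

text \<open>
  The subtraction below is \<^typ>\<open>ereal\<close> subtraction: since the right-hand side is finite, the
  inequality forces both the value and the infimum of the augmented Lagrangian to be
  finite (in particular \<open>\<infinity> - \<infinity>\<close> and \<open>a - (-\<infinity>)\<close> evaluate to \<open>\<infinity>\<close>). The starting
  multiplier is \<open>lam 0\<close>; the values \<open>x 0\<close>, \<open>y 0\<close>, \<open>s 0\<close> and \<open>eps 0\<close> play no role.
\<close>

definition ialm ::
  "'a set \<Rightarrow> ('a \<Rightarrow> ereal) \<Rightarrow> ('a \<Rightarrow> 'b::real_inner) \<Rightarrow> 'b set \<Rightarrow>
   (nat \<Rightarrow> real) \<Rightarrow> (nat \<Rightarrow> real) \<Rightarrow>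
   (nat \<Rightarrow> 'a) \<Rightarrow> (nat \<Rightarrow> 'b) \<Rightarrow> (nat \<Rightarrow> 'b) \<Rightarrow> (nat \<Rightarrow> 'b) \<Rightarrow> bool" where
  "ialm X f C K gam eps x y lam s \<longleftrightarrow>
    (\<forall>k. x (Suc k) \<in> X \<and> y (Suc k) \<in> K \<and>
         s (Suc k) = C (x (Suc k)) - y (Suc k) \<and>
         aug_lagrangian f (gam k) (x (Suc k)) (s (Suc k)) (lam k)
           - (INF (x', s')\<in>constraint_graph X C K. aug_lagrangian f (gam k) x' s' (lam k))
           \<le> ereal ((eps (Suc k))\<^sup>2 / (2 * gam k)) \<and>
         lam (Suc k) = lam k - gam k *\<^sub>R s (Suc k))"

text \<open>Series over \<open>k \<ge> 1\<close> are reindexed by \<^const>\<open>Suc\<close>.\<close>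

definition error_step_conditions :: "(nat \<Rightarrow> real) \<Rightarrow> (nat \<Rightarrow> real) \<Rightarrow> bool" where
  "error_step_conditions gam eps \<longleftrightarrow>
    (\<forall>k. gam k > 0) \<and> (\<forall>k\<ge>1. eps k \<ge> 0) \<and>
    summable (\<lambda>k. eps (Suc k)) \<and>
    (\<lambda>k. eps (Suc k) / gam k * (\<Sum>i=0..k. gam i)) \<in> O(\<lambda>k. 1 / sqrt (\<Sum>i=0..k. gam i)) \<and>
    summable (\<lambda>k. (eps (Suc k) / gam (Suc k))\<^sup>2 * (\<Sum>i=0..k. gam i)) \<and>
    summable (\<lambda>k. eps (Suc k) / gam (Suc k) * (\<Sum>i=1..Suc k. gam (i - 1))) \<and>
    filterlim (\<lambda>n. \<Sum>k<n. gam k) at_top sequentially"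

text \<open>
  The last clause spells out the \<open>O\<close>-estimate for the extended-real quantity
  \<open>\<bar>f (x k) - \<nu>\<bar>\<close>, so that it also asserts that this quantity is eventually finite.
\<close>

definition quant_conv_closest_feasible ::
  "'a set \<Rightarrow> ('a \<Rightarrow> ereal) \<Rightarrow> ('a \<Rightarrow> 'b::real_inner) \<Rightarrow> 'b set \<Rightarrow>
   (nat \<Rightarrow> real) \<Rightarrow> (nat \<Rightarrow> 'a) \<Rightarrow> (nat \<Rightarrow> 'b) \<Rightarrow> bool" where
  "quant_conv_closest_feasible X f C K gam x y \<longleftrightarrow>
    (let sbar = min_violation X f C K;
         nubar = value_fun X f C K sbar;
         rate = (\<lambda>k. 1 / sqrt (\<Sum>i<k. gam i))
     in (\<lambda>k. f (x k)) \<longlonglongrightarrow> nubar \<and>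
        (\<lambda>k. C (x k) - y k) \<longlonglongrightarrow> sbar \<and>
        (\<lambda>k. norm (y k - metric_proj K (C (x k)))) \<longlonglongrightarrow> 0 \<and>
        (\<lambda>k. norm (C (x k) - y k - sbar)) \<in> O(rate) \<and>
        (\<lambda>k. norm (y k - metric_proj K (C (x k)))) \<in> O(rate) \<and>
        (\<exists>c. \<forall>\<^sub>F k in sequentially. \<bar>f (x k) - nubar\<bar> \<le> ereal (c * rate k)))"

end

theory Submission
  imports Defs
begin

text \<open>
  An augmented Lagrangian step is a proximal step for the conjugate of the value function
  \<open>\<nu>\<close>: the exact step \<open>s\<^sub>E\<close> gives a multiplier \<open>\<lambda> - \<gamma> s\<^sub>E\<close> in \<open>\<partial>\<nu>(s\<^sub>E)\<close>, and
  strong convexity bounds the distance to the inexact one by \<open>\<epsilon> / \<gamma>\<close>. Let \<open>\<Gamma>\<close> be the sum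
  of the penalties, \<open>\<sigma> = s\<^sub>E - sbar\<close> and \<open>l \<in> \<partial>\<nu>(sbar)\<close>. Because
  \<open>\<langle>sbar, \<sigma>\<rangle> \<ge> 0\<close>, the corrected multipliers \<open>\<lambda> + \<Gamma> sbar - l\<close> are quasi-Fejer, hence
  bounded. Combined with the decrease of the dual gap weighted by \<open>\<Gamma>\<close>, this makes the sum of
  \<open>\<gamma> \<Gamma> (|s\<^sub>E|\<^sup>2 - |sbar|\<^sup>2)\<close> finite. By monotonicity of the subdifferential, \<open>|s\<^sub>E|\<^sup>2\<close> decreases
  up to \<open>(\<epsilon> / \<gamma>)\<^sup>2\<close>, so the last iterate satisfies \<open>|s\<^sub>E|\<^sup>2 - |sbar|\<^sup>2 = O(1 / \<Gamma>)\<close>, a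
  quantity that dominates both \<open>|\<sigma>|\<^sup>2\<close> and the squared distance of \<open>y\<close> to the projection.
\<close>

section \<open>Minimizing quadratic perturbations over convex sets\<close>

text \<open>The augmented Lagrangian with multiplier \<open>l\<close> and penalty \<open>g\<close>,
  read on a pair of a violation and an objective level.\<close>

definition quad_pert :: "'b::real_inner \<Rightarrow> real \<Rightarrow> 'b \<times> real \<Rightarrow> real" where
  "quad_pert l g z = snd z - inner l (fst z) + g / 2 * (norm (fst z))\<^sup>2"

lemma continuous_on_quad_pert [continuous_intros]:
  "continuous_on A (quad_pert l g)"
  unfolding quad_pert_def by (intro continuous_intros)

lemma quad_pert_convex_combination:
  "quad_pert l g ((1 - t) *\<^sub>R a + t *\<^sub>R b) =
     (1 - t) * quad_pert l g a + t * quad_pert l g b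
       - g / 2 * (t * (1 - t)) * (norm (fst a - fst b))\<^sup>2"
  unfolding quad_pert_def power2_norm_eq_inner
  by (simp add: inner_commute inner_add_left inner_add_right inner_diff_left inner_diff_right
      field_simps)

text \<open>The function is quadratic, so its expansion at \<open>(s', v')\<close> is exact; the
  linear coefficient \<open>l - g *\<^sub>R s'\<close> is the updated multiplier.\<close>

lemma quad_pert_expand:
  "quad_pert l g (s, v) - quad_pert l g (s', v') =
     v - v' - inner (l - g *\<^sub>R s') (s - s') + g / 2 * (norm (s - s'))\<^sup>2"
  unfolding quad_pert_def power2_norm_eq_inner
  by (simp add: inner_commute inner_diff_left inner_diff_right field_simps)

text \<open>Strong convexity in the first component makes the violations of a minimizing sequence
  Cauchy; convergence of the values then forces the second components to converge. The limit may
  leave \<open>G\<close>, hence the closure. Its first-order condition is a subgradient inequality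
  for the updated multiplier.\<close>

lemma quad_pert_minimum:
  fixes G :: "('b::{real_inner, complete_space} \<times> real) set"
  assumes cvx: "convex G" and ne: "G \<noteq> {}" and g: "g > 0"
    and bdd: "\<And>z. z \<in> G \<Longrightarrow> b \<le> quad_pert l g z"
  obtains s v where "(s, v) \<in> closure G"
    and "\<And>t w. (t, w) \<in> closure G \<Longrightarrow> v + inner (l - g *\<^sub>R s) (t - s) \<le> w"
proof -
  let ?q = "quad_pert l g"
  define m where "m = Inf (?q ` G)"
  have m_le: "m \<le> ?q z" if "z \<in> G" for z
    unfolding m_def using bdd that by (intro cINF_lower bdd_belowI2[of _ b]) auto
  have "\<exists>z\<in>G. ?q z < m + inverse (real (Suc n))" for n
    using cInf_lessD[of "?q ` G" "m + inverse (real (Suc n))"] ne by (auto simp: m_def)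
  then obtain z where zG: "\<And>n. z n \<in> G" and zq: "\<And>n. ?q (z n) < m + inverse (real (Suc n))"
    by metis
  have gap: "g / 2 * (t * (1 - t)) * (norm (fst a - fst b))\<^sup>2
      \<le> (1 - t) * (?q a - m) + t * (?q b - m)"
    if "a \<in> G" "b \<in> G" "0 \<le> t" "t \<le> 1" for a b t
  proof -
    have "(1 - t) *\<^sub>R a + t *\<^sub>R b \<in> G"
      using cvx that by (intro convexD) auto
    from m_le[OF this] show ?thesis
      unfolding quad_pert_convex_combination by (simp add: algebra_simps)
  qed
  have qlim: "(\<lambda>n. ?q (z n)) \<longlonglongrightarrow> m"
  proof (rule tendsto_sandwich[OF _ _ tendsto_const])
    show "(\<lambda>n. m + inverse (real (Suc n))) \<longlonglongrightarrow> m"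
      using tendsto_add[OF tendsto_const[of m] LIMSEQ_inverse_real_of_nat] by simp
    show "\<forall>\<^sub>F n in sequentially. m \<le> ?q (z n)"
      using m_le zG by simp
    show "\<forall>\<^sub>F n in sequentially. ?q (z n) \<le> m + inverse (real (Suc n))"
      using zq less_imp_le by (intro always_eventually) blast
  qed
  have "Cauchy (\<lambda>n. fst (z n))"
  proof (rule metric_CauchyI)
    fix e :: real assume e: "e > 0"
    have "\<forall>\<^sub>F n in sequentially. ?q (z n) < m + g / 8 * e\<^sup>2"
      using e g by (intro order_tendstoD(2)[OF qlim]) auto
    then obtain N where N: "\<And>n. n \<ge> N \<Longrightarrow> ?q (z n) < m + g / 8 * e\<^sup>2"
      by (auto simp: eventually_sequentially)
    have "dist (fst (z i)) (fst (z j)) < e" if "i \<ge> N" "j \<ge> N" for i j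
    proof -
      have "g / 8 * (norm (fst (z i) - fst (z j)))\<^sup>2 \<le> (?q (z i) - m) / 2 + (?q (z j) - m) / 2"
        using gap[OF zG[of i] zG[of j], of "1/2"] by simp
      also have "\<dots> < g / 8 * e\<^sup>2"
        using N[OF that(1)] N[OF that(2)] by argo
      finally have "(norm (fst (z i) - fst (z j)))\<^sup>2 < e\<^sup>2"
        using g by simp
      then show ?thesis
        using e by (simp add: dist_norm power2_less_imp_less)
    qed
    then show "\<exists>M. \<forall>i\<ge>M. \<forall>j\<ge>M. dist (fst (z i)) (fst (z j)) < e"
      by blast
  qed
  then obtain s where s: "(\<lambda>n. fst (z n)) \<longlonglongrightarrow> s"
    using Cauchy_convergent convergent_def by blast
  define v where "v = m + inner l s - g / 2 * (norm s)\<^sup>2"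
  have "(\<lambda>n. ?q (z n) + inner l (fst (z n)) - g / 2 * (norm (fst (z n)))\<^sup>2) \<longlonglongrightarrow> v"
    unfolding v_def by (intro tendsto_intros qlim s)
  then have v: "(\<lambda>n. snd (z n)) \<longlonglongrightarrow> v"
    by (simp add: quad_pert_def)
  have zlim: "z \<longlonglongrightarrow> (s, v)"
    using tendsto_Pair[OF s v] by simp
  have mem: "(s, v) \<in> closure G"
    using zG zlim by (auto simp: closure_sequential)
  have qm: "?q (s, v) = m"
    by (simp add: quad_pert_def v_def)
  have var: "v + inner (l - g *\<^sub>R s) (fst b - s) \<le> snd b" if b: "b \<in> G" for b
  proof -
    \<comment> \<open>Letting \<open>t\<close> tend to 0 yields quadratic growth with the full
      constant \<open>g / 2\<close>. This is exactly the quadratic term of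
      \<open>quad_pert_expand\<close>, so a linear inequality remains.\<close>
    have "g / 2 * (1 - t) * (norm (s - fst b))\<^sup>2 \<le> ?q b - m" if t: "0 < t" "t < 1" for t
    proof -
      have "(\<lambda>n. g / 2 * (t * (1 - t)) * (norm (fst (z n) - fst b))\<^sup>2)
          \<longlonglongrightarrow> g / 2 * (t * (1 - t)) * (norm (s - fst b))\<^sup>2"
        by (intro tendsto_intros s)
      moreover have "(\<lambda>n. (1 - t) * (?q (z n) - m) + t * (?q b - m))
          \<longlonglongrightarrow> (1 - t) * (m - m) + t * (?q b - m)"
        by (intro tendsto_intros qlim)
      ultimately have "g / 2 * (t * (1 - t)) * (norm (s - fst b))\<^sup>2
          \<le> (1 - t) * (m - m) + t * (?q b - m)"
        using gap[OF zG b, of t] t by (intro LIMSEQ_le) auto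
      then have "t * (g / 2 * (1 - t) * (norm (s - fst b))\<^sup>2) \<le> t * (?q b - m)"
        by (simp add: algebra_simps)
      then show ?thesis using t by simp
    qed
    then have "\<forall>\<^sub>F t in at_right 0. g / 2 * (1 - t) * (norm (s - fst b))\<^sup>2 \<le> ?q b - m"
      unfolding eventually_at_right_field by (intro exI[of _ 1]) auto
    moreover have "((\<lambda>t. g / 2 * (1 - t) * (norm (s - fst b))\<^sup>2)
        \<longlongrightarrow> g / 2 * (1 - 0) * (norm (s - fst b))\<^sup>2) (at_right (0::real))"
      by (intro tendsto_intros)
    ultimately have "g / 2 * (norm (s - fst b))\<^sup>2 \<le> ?q b - m"
      using tendsto_upperbound[of _ _ "at_right (0::real)"] by fastforce
    then show ?thesis
      using quad_pert_expand[of l g "fst b" "snd b" s v] qm by (simp add: norm_minus_commute)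
  qed
  have "closure G \<subseteq> {b. v + inner (l - g *\<^sub>R s) (fst b - s) \<le> snd b}"
    using var by (intro closure_minimal closed_Collect_le continuous_intros) auto
  then show ?thesis
    using mem by (intro that[of s v]) auto
qed

text \<open>On \<open>A \<times> {0}\<close>, with multiplier \<open>u\<close> and penalty 1, the
  quadratic perturbation is half the squared distance to \<open>u\<close> minus a constant.\<close>

lemma projection_exists:
  fixes A :: "'b::{real_inner, complete_space} set"
  assumes "closed A" "convex A" "A \<noteq> {}"
  obtains p where "p \<in> A" "\<And>a. a \<in> A \<Longrightarrow> inner (u - p) (a - p) \<le> 0"
proof -
  have "0 \<le> (norm (fst z - u))\<^sup>2 / 2" for z :: "'b \<times> real"
    by simp
  then have bdd: "- ((norm u)\<^sup>2 / 2) \<le> quad_pert u 1 z" if "snd z = 0" for z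
    using that unfolding quad_pert_def power2_norm_eq_inner
    by (simp add: inner_diff_left inner_diff_right inner_commute field_simps)
  obtain p v where p: "(p, v) \<in> closure (A \<times> {0})"
    and var: "\<And>t w. (t, w) \<in> closure (A \<times> {0}) \<Longrightarrow> v + inner (u - 1 *\<^sub>R p) (t - p) \<le> w"
  proof (rule quad_pert_minimum)
    show "convex (A \<times> {0::real})"
      using assms by (simp add: convex_Times)
    show "A \<times> {0::real} \<noteq> {}"
      using assms by simp
    show "- ((norm u)\<^sup>2 / 2) \<le> quad_pert u 1 z" if "z \<in> A \<times> {0}" for z
      using bdd that by auto
  qed auto
  have "p \<in> A" "v = 0"
    using p assms by (auto simp: closure_Times)
  moreover have "inner (u - p) (a - p) \<le> 0" if "a \<in> A" for a
    using var[of a 0] that assms \<open>v = 0\<close> by (auto simp: closure_Times)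
  ultimately show ?thesis
    using that by blast
qed

text \<open>Since \<open>arg_min_on\<close> is a choice, existence and uniqueness of the nearest
  point both enter: expanding the squared distance around the projection shows that every minimizer
  equals it.\<close>

lemma arg_min_dist:
  fixes A :: "'b::{real_inner, complete_space} set" and u :: 'b
  assumes "closed A" "convex A" "A \<noteq> {}"
  defines "p \<equiv> arg_min_on (\<lambda>a. norm (u - a)) A"
  shows "p \<in> A" and "\<And>a. a \<in> A \<Longrightarrow> inner (u - p) (a - p) \<le> 0"
proof -
  obtain q where q: "q \<in> A" "\<And>a. a \<in> A \<Longrightarrow> inner (u - q) (a - q) \<le> 0"
    using projection_exists[OF assms(1-3), of u] by metis
  have expand: "(norm (u - a))\<^sup>2 = (norm (u - q))\<^sup>2 - 2 * inner (u - q) (a - q) + (norm (a - q))\<^sup>2" for a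
    unfolding power2_norm_eq_inner
    by (simp add: inner_diff_left inner_diff_right inner_commute)
  have "norm (u - q) \<le> norm (u - a)" if "a \<in> A" for a
  proof (rule power2_le_imp_le)
    show "(norm (u - q))\<^sup>2 \<le> (norm (u - a))\<^sup>2"
      using expand[of a] q(2)[OF that] zero_le_power2[of "norm (a - q)"] by linarith
  qed simp
  then have "is_arg_min (\<lambda>a. norm (u - a)) (\<lambda>a. a \<in> A) q"
    using q(1) by (auto simp: is_arg_min_linorder)
  then have "is_arg_min (\<lambda>a. norm (u - a)) (\<lambda>a. a \<in> A) p"
    unfolding p_def arg_min_on_def arg_min_def by (rule someI)
  then have p: "p \<in> A" "norm (u - p) \<le> norm (u - q)"
    using q(1) by (auto simp: is_arg_min_linorder)
  have "(norm (u - p))\<^sup>2 \<le> (norm (u - q))\<^sup>2"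
    using p(2) by (intro power_mono) auto
  then have "(norm (p - q))\<^sup>2 \<le> 0"
    using expand[of p] q(2)[OF p(1)] by linarith
  then have "p = q"
    by simp
  then show "p \<in> A" and "\<And>a. a \<in> A \<Longrightarrow> inner (u - p) (a - p) \<le> 0"
    using q by auto
qed

section \<open>Inexact proximal iterations\<close>

text \<open>Here \<open>G\<close> pairs violations with upper bounds of the objective,
  \<open>v\<close> holds the computed objective values, and \<open>lbar\<close> is a subgradient at
  \<open>sbar\<close>. In \<open>target\<close> the closure appears because the infimum defining
  \<open>nubar\<close> may not be attained; \<open>c2\<close> is a constant for A2 valid at every
  index.\<close>

locale inexact_prox_iteration =
  fixes G :: "('b::{real_inner, complete_space} \<times> real) set"
    and sbar lbar :: 'b and nubar c2 :: real
    and gam eps :: "nat \<Rightarrow> real" and lam s :: "nat \<Rightarrow> 'b" and v :: "nat \<Rightarrow> real"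
  assumes cvx: "convex G"
    and target: "(sbar, nubar) \<in> closure G"
    and subgradient: "\<And>t w. (t, w) \<in> G \<Longrightarrow> nubar + inner lbar (t - sbar) \<le> w"
    and least_violation: "\<And>t w. (t, w) \<in> G \<Longrightarrow> 0 \<le> inner sbar (t - sbar)"
    and gam_pos: "\<And>k. gam k > 0"
    and eps_nonneg: "\<And>k. eps (Suc k) \<ge> 0"
    and step_mem: "\<And>k. (s (Suc k), v (Suc k)) \<in> G"
    and step_opt: "\<And>k z. z \<in> G \<Longrightarrow>
      quad_pert (lam k) (gam k) (s (Suc k), v (Suc k))
        \<le> quad_pert (lam k) (gam k) z + (eps (Suc k))\<^sup>2 / (2 * gam k)"
    and lam_Suc: "\<And>k. lam (Suc k) = lam k - gam k *\<^sub>R s (Suc k)"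
    and A1: "summable (\<lambda>k. eps (Suc k))"
    and A2: "\<And>k. eps (Suc k) / gam k * (\<Sum>i<Suc k. gam i) \<le> c2 / sqrt (\<Sum>i<Suc k. gam i)"
    and A3: "summable (\<lambda>k. (eps (Suc k) / gam (Suc k))\<^sup>2 * (\<Sum>i<Suc k. gam i))"
    and A4: "summable (\<lambda>k. eps (Suc k) / gam (Suc k) * (\<Sum>i<Suc k. gam i))"
begin

section \<open>Extension of the hypotheses to the closure, and penalty sums\<close>

lemma subgradient_closure: "(t, w) \<in> closure G \<Longrightarrow> nubar + inner lbar (t - sbar) \<le> w"
proof -
  have "closure G \<subseteq> {z. nubar + inner lbar (fst z - sbar) \<le> snd z}"
    using subgradient by (intro closure_minimal closed_Collect_le continuous_intros) auto
  then show "(t, w) \<in> closure G \<Longrightarrow> ?thesis" by auto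
qed

lemma least_violation_closure: "(t, w) \<in> closure G \<Longrightarrow> 0 \<le> inner sbar (t - sbar)"
proof -
  have "closure G \<subseteq> {z. 0 \<le> inner sbar (fst z - sbar)}"
    using least_violation by (intro closure_minimal closed_Collect_le continuous_intros) auto
  then show "(t, w) \<in> closure G \<Longrightarrow> ?thesis" by auto
qed

lemma step_opt_closure:
  assumes "z \<in> closure G"
  shows "quad_pert (lam k) (gam k) (s (Suc k), v (Suc k))
    \<le> quad_pert (lam k) (gam k) z + (eps (Suc k))\<^sup>2 / (2 * gam k)"
proof -
  have "closure G \<subseteq> {z. quad_pert (lam k) (gam k) (s (Suc k), v (Suc k))
    \<le> quad_pert (lam k) (gam k) z + (eps (Suc k))\<^sup>2 / (2 * gam k)}"
    using step_opt by (intro closure_minimal closed_Collect_le continuous_intros) auto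
  then show ?thesis using assms by auto
qed

definition total :: "nat \<Rightarrow> real" where
  "total n = (\<Sum>i<n. gam i)"

lemma total_Suc: "total (Suc n) = total n + gam n"
  by (simp add: total_def)

lemma total_nonneg: "total n \<ge> 0"
  using gam_pos by (auto simp: total_def less_imp_le intro!: sum_nonneg)

lemma total_Suc_ge: "gam 0 \<le> total (Suc n)"
  unfolding total_def by (rule member_le_sum) (auto simp: gam_pos less_imp_le)

lemma total_Suc_pos: "total (Suc n) > 0"
  using total_Suc_ge gam_pos less_le_trans by blast

text \<open>Index shift: \<open>exact_step k\<close> is the exact counterpart of \<open>(s (Suc k), v (Suc k))\<close>.\<close>

definition exact_step :: "nat \<Rightarrow> 'b \<times> real" where
  "exact_step k = (SOME z. z \<in> closure G \<and>
     (\<forall>(t, w) \<in> closure G. snd z + inner (lam k - gam k *\<^sub>R fst z) (t - fst z) \<le> w))"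

abbreviation sE :: "nat \<Rightarrow> 'b" where "sE k \<equiv> fst (exact_step k)"
abbreviation vE :: "nat \<Rightarrow> real" where "vE k \<equiv> snd (exact_step k)"
abbreviation lE :: "nat \<Rightarrow> 'b" where "lE k \<equiv> lam k - gam k *\<^sub>R sE k"

lemma exact_step:
  shows exact_mem: "(sE k, vE k) \<in> closure G"
    and exact_var: "(t, w) \<in> closure G \<Longrightarrow> vE k + inner (lE k) (t - sE k) \<le> w"
proof -
  obtain s' v' where "(s', v') \<in> closure G"
    "\<And>t w. (t, w) \<in> closure G \<Longrightarrow> v' + inner (lam k - gam k *\<^sub>R s') (t - s') \<le> w"
  proof (rule quad_pert_minimum[OF cvx _ gam_pos[of k]])
    show "G \<noteq> {}" using step_mem by auto
    show "quad_pert (lam k) (gam k) (s (Suc k), v (Suc k)) - (eps (Suc k))\<^sup>2 / (2 * gam k)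
        \<le> quad_pert (lam k) (gam k) z" if "z \<in> G" for z
      using step_opt[OF that, of k] by simp
  qed blast
  then have "\<exists>z. z \<in> closure G \<and>
     (\<forall>(t, w) \<in> closure G. snd z + inner (lam k - gam k *\<^sub>R fst z) (t - fst z) \<le> w)"
    by (intro exI[of _ "(s', v')"]) auto
  from someI_ex[OF this] show "(sE k, vE k) \<in> closure G"
    and "(t, w) \<in> closure G \<Longrightarrow> vE k + inner (lE k) (t - sE k) \<le> w"
    unfolding exact_step_def[symmetric] by auto
qed

text \<open>By \<open>exact_var\<close> the linear part of the expansion at the exact step is
  nonnegative, so the tolerance bounds the quadratic part alone.\<close>

lemma step_error: "norm (s (Suc k) - sE k) \<le> eps (Suc k) / gam k"
proof -
  have "vE k + inner (lE k) (s (Suc k) - sE k) \<le> v (Suc k)"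
    using exact_var step_mem closure_subset by blast
  moreover have "quad_pert (lam k) (gam k) (s (Suc k), v (Suc k))
      \<le> quad_pert (lam k) (gam k) (sE k, vE k) + (eps (Suc k))\<^sup>2 / (2 * gam k)"
    using exact_mem by (rule step_opt_closure)
  ultimately have "gam k / 2 * (norm (s (Suc k) - sE k))\<^sup>2 \<le> (eps (Suc k))\<^sup>2 / (2 * gam k)"
    using quad_pert_expand[of "lam k" "gam k" "s (Suc k)" "v (Suc k)" "sE k" "vE k"] by linarith
  then have "(norm (s (Suc k) - sE k))\<^sup>2 \<le> (eps (Suc k) / gam k)\<^sup>2"
    using gam_pos[of k] by (simp add: field_simps power2_eq_square)
  then show ?thesis
    by (rule power2_le_imp_le) (intro divide_nonneg_pos gam_pos eps_nonneg)
qed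

text \<open>The factor \<open>gam k\<close> of the multiplier update cancels the denominator in
  \<open>step_error\<close>, so A1 sums these errors.\<close>

lemma multiplier_error: "norm (lam (Suc k) - lE k) \<le> eps (Suc k)"
proof -
  have "lam (Suc k) - lE k = - (gam k *\<^sub>R (s (Suc k) - sE k))"
    by (simp add: lam_Suc scaleR_diff_right)
  then have "norm (lam (Suc k) - lE k) = gam k * norm (s (Suc k) - sE k)"
    using gam_pos[of k] by simp
  also have "\<dots> \<le> gam k * (eps (Suc k) / gam k)"
    using step_error gam_pos[of k] by (intro mult_left_mono) auto
  finally show ?thesis using gam_pos[of k] by simp
qed

text \<open>
  In the infeasible case the multipliers diverge like \<open>- total k *\<^sub>R sbar\<close>; adding this drift
  back gives a sequence that stays bounded.
\<close>

definition drift :: "nat \<Rightarrow> 'b" where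
  "drift k = lam k + total k *\<^sub>R sbar - lbar"

definition driftE :: "nat \<Rightarrow> 'b" where
  "driftE k = lE k + total (Suc k) *\<^sub>R sbar - lbar"

text \<open>The Fenchel-Young gap at \<open>sbar\<close> and \<open>lE k\<close>: by
  \<open>exact_var\<close>, \<open>inner (lE k) (sE k) - vE k\<close> is the supremum of
  \<open>inner (lE k) t - w\<close> over \<open>closure G\<close>.\<close>

definition gap :: "nat \<Rightarrow> real" where
  "gap k = nubar - vE k + inner (lE k) (sE k - sbar)"

definition excess :: "nat \<Rightarrow> real" where
  "excess k = (norm (sE k))\<^sup>2 - (norm sbar)\<^sup>2"

section \<open>Nonnegative quantities and the Fejer inequality\<close>

lemma drift_eq: "drift k = driftE k + gam k *\<^sub>R (sE k - sbar)"
  by (simp add: drift_def driftE_def total_Suc algebra_simps)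

lemma drift_Suc: "drift (Suc k) - driftE k = lam (Suc k) - lE k"
  by (simp add: drift_def driftE_def)

lemma gap_nonneg: "gap k \<ge> 0"
  using exact_var[OF target, of k]
  by (simp add: gap_def inner_diff_right)

lemma norm2_diff_eq:
  "(norm t)\<^sup>2 - (norm sbar)\<^sup>2 = (norm (t - sbar))\<^sup>2 + 2 * inner sbar (t - sbar)"
  unfolding power2_norm_eq_inner by (simp add: inner_diff_left inner_diff_right inner_commute)

lemma excess_eq: "excess k = (norm (sE k - sbar))\<^sup>2 + 2 * inner sbar (sE k - sbar)"
  unfolding excess_def by (rule norm2_diff_eq)

lemma excess_nonneg: "excess k \<ge> 0"
  using least_violation_closure[OF exact_mem] by (auto simp: excess_eq intro!: add_nonneg_nonneg)

lemma gap_le: "gap k \<le> inner (driftE k) (sE k - sbar) - total (Suc k) * inner sbar (sE k - sbar)"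
  using subgradient_closure[OF exact_mem, of k]
  by (simp add: gap_def driftE_def inner_add_left inner_diff_left)

text \<open>The vectors \<open>drift k\<close> and \<open>driftE k\<close> differ by
  \<open>gam k *\<^sub>R (sE k - sbar)\<close>. Expanding the square leaves a cross term with
  \<open>driftE k\<close>, which \<open>gap_le\<close> bounds from below.\<close>

lemma fejer:
  "(norm (driftE k))\<^sup>2 + 2 * gam k * gap k
     + 2 * gam k * total (Suc k) * inner sbar (sE k - sbar)
     + (gam k)\<^sup>2 * (norm (sE k - sbar))\<^sup>2 \<le> (norm (drift k))\<^sup>2"
proof -
  have "(norm (drift k))\<^sup>2 = (norm (driftE k))\<^sup>2 + 2 * gam k * inner (driftE k) (sE k - sbar)
      + (gam k)\<^sup>2 * (norm (sE k - sbar))\<^sup>2"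
    unfolding drift_eq power2_norm_eq_inner
    by (simp add: inner_add_left inner_add_right inner_commute power2_eq_square algebra_simps)
  moreover have "2 * gam k * gap k
      \<le> 2 * gam k * (inner (driftE k) (sE k - sbar) - total (Suc k) * inner sbar (sE k - sbar))"
    using gap_le gam_pos[of k] by (intro mult_left_mono) auto
  ultimately show ?thesis
    by (simp add: algebra_simps)
qed

lemma driftE_le: "norm (driftE k) \<le> norm (drift k)"
proof -
  have "0 \<le> 2 * gam k * gap k" "0 \<le> 2 * gam k * total (Suc k) * inner sbar (sE k - sbar)"
    "0 \<le> (gam k)\<^sup>2 * (norm (sE k - sbar))\<^sup>2"
    using gap_nonneg[of k] gam_pos[of k] total_nonneg[of "Suc k"]
      least_violation_closure[OF exact_mem, of k] by auto
  then show ?thesis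
    using fejer[of k] by (intro power2_le_imp_le[OF _ norm_ge_zero]) linarith
qed

section \<open>Summable errors and boundedness of the drift\<close>

definition eps_sum :: real where
  "eps_sum = (\<Sum>k. eps (Suc k))"

lemma eps_sum_partial: "(\<Sum>k<n. eps (Suc k)) \<le> eps_sum"
  unfolding eps_sum_def using A1 eps_nonneg by (intro sum_le_suminf) auto

lemma eps_sum_nonneg: "0 \<le> eps_sum"
  using eps_sum_partial[of 0] by simp

lemma eps_le: "eps (Suc k) \<le> eps_sum"
proof -
  have "eps (Suc k) \<le> (\<Sum>j<Suc k. eps (Suc j))"
    using eps_nonneg by (auto intro!: sum_nonneg)
  then show ?thesis using eps_sum_partial[of "Suc k"] by simp
qed

definition radius :: real where
  "radius = norm (drift 0) + eps_sum"

lemma radius_nonneg: "0 \<le> radius"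
  by (simp add: radius_def eps_sum_nonneg)

lemma norm_drift_le: "norm (drift k) \<le> radius"
proof -
  have "norm (drift k) \<le> norm (drift 0) + (\<Sum>j<k. eps (Suc j))"
  proof (induction k)
    case (Suc k)
    have "norm (drift (Suc k)) \<le> norm (driftE k) + norm (drift (Suc k) - driftE k)"
      by (metis add.commute norm_triangle_sub)
    also have "\<dots> \<le> norm (drift k) + eps (Suc k)"
      using driftE_le multiplier_error by (simp add: drift_Suc add_mono)
    finally show ?case using Suc by simp
  qed simp
  then show ?thesis
    using eps_sum_partial[of k] by (simp add: radius_def)
qed

text \<open>Boundedness of the drift makes the perturbation of the square linear in
  \<open>eps (Suc k)\<close>, hence summable.\<close>

lemma norm2_drift_Suc_le:
  "(norm (drift (Suc k)))\<^sup>2 \<le> (norm (driftE k))\<^sup>2 + eps (Suc k) * (2 * radius + eps_sum)"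
proof -
  have "norm (drift (Suc k)) \<le> norm (driftE k) + norm (drift (Suc k) - driftE k)"
    by (metis add.commute norm_triangle_sub)
  also have "\<dots> \<le> norm (driftE k) + eps (Suc k)"
    using multiplier_error by (simp add: drift_Suc)
  finally have "(norm (drift (Suc k)))\<^sup>2 \<le> (norm (driftE k) + eps (Suc k))\<^sup>2"
    by (intro power_mono) auto
  also have "\<dots> = (norm (driftE k))\<^sup>2 + eps (Suc k) * (2 * norm (driftE k) + eps (Suc k))"
    by (simp add: power2_eq_square algebra_simps)
  also have "\<dots> \<le> (norm (driftE k))\<^sup>2 + eps (Suc k) * (2 * radius + eps_sum)"
    using driftE_le[of k] norm_drift_le[of k] eps_le[of k] eps_nonneg
    by (intro add_left_mono mult_left_mono) auto
  finally show ?thesis .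
qed

section \<open>Descent of the dual gap and of the potential\<close>

lemma exact_descent:
  "inner (lE k - lE (Suc k)) (sE (Suc k) - sbar) \<le> gap k - gap (Suc k)"
  \<comment> \<open>The subgradient inequality of index \<open>k\<close> is tested at the exact
    point of index \<open>Suc k\<close>.\<close>
  using exact_var[OF exact_mem, of k "Suc k"]
  by (simp add: gap_def inner_diff_left inner_diff_right algebra_simps)

lemma lE_diff:
  "lE k - lE (Suc k) = gam (Suc k) *\<^sub>R sE (Suc k) - (lam (Suc k) - lE k)"
  by simp

lemma gap_descent:
  "gap (Suc k) + gam (Suc k) / 2 * (norm (sE (Suc k) - sbar))\<^sup>2
     \<le> gap k + (eps (Suc k))\<^sup>2 / (2 * gam (Suc k))"
proof -
  let ?S = "sE (Suc k) - sbar" and ?g = "gam (Suc k)" and ?e = "eps (Suc k)"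
  have "inner (lam (Suc k) - lE k) ?S \<le> ?e * norm ?S"
    using norm_cauchy_schwarz[of "lam (Suc k) - lE k" ?S] multiplier_error[of k]
    by (meson mult_right_mono norm_ge_zero order_trans)
  moreover have "inner (sE (Suc k)) ?S = (norm ?S)\<^sup>2 + inner sbar ?S"
    unfolding power2_norm_eq_inner by (simp add: inner_diff_left inner_diff_right)
  ultimately have "?g * (norm ?S)\<^sup>2 + ?g * inner sbar ?S - ?e * norm ?S \<le> gap k - gap (Suc k)"
    using exact_descent[of k] unfolding lE_diff
    by (simp add: inner_diff_left distrib_left)
  moreover have "0 \<le> ?g * inner sbar ?S"
    using gam_pos[of "Suc k"] least_violation_closure[OF exact_mem, of "Suc k"] by auto
  \<comment> \<open>Young's inequality: half of the quadratic term absorbs the multiplier error, the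
    other half stays in the descent.\<close>
  moreover have "?e * norm ?S \<le> ?g / 2 * (norm ?S)\<^sup>2 + ?e\<^sup>2 / (2 * ?g)"
  proof -
    have "0 \<le> (?g * norm ?S - ?e)\<^sup>2 / (2 * ?g)"
      using gam_pos[of "Suc k"] by simp
    then show ?thesis
      using gam_pos[of "Suc k"] by (simp add: power2_eq_square field_simps)
  qed
  ultimately show ?thesis by (simp add: field_simps)
qed

text \<open>
  The weight of \<open>excess j\<close> arises as \<open>gam j * total j\<close> from the descent of the gap plus
  \<open>(gam j)\<^sup>2\<close> from the Fejer inequality.
\<close>

definition potential :: "nat \<Rightarrow> real" where
  "potential k = 2 * total (Suc k) * gap k + (norm (drift (Suc k)))\<^sup>2
     + (\<Sum>j\<le>k. gam j * total (Suc j) * excess j)"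

lemma potential_0: "potential 0 \<le> (norm (drift 0))\<^sup>2 + eps 1 * (2 * radius + eps_sum)"
  using fejer[of 0] norm2_drift_Suc_le[of 0]
  by (simp add: potential_def excess_eq total_def power2_eq_square algebra_simps)

text \<open>Add \<open>2 * total (Suc k)\<close> times \<open>gap_descent\<close> to
  \<open>fejer\<close> at \<open>Suc k\<close>: the gap term of the latter raises the weight of the
  new gap to \<open>total (Suc (Suc k))\<close>, and its term in \<open>inner sbar\<close> completes
  \<open>excess (Suc k)\<close>.\<close>

lemma potential_Suc:
  "potential (Suc k) \<le> potential k + eps (Suc (Suc k)) * (2 * radius + eps_sum)
     + eps_sum * (eps (Suc k) / gam (Suc k) * total (Suc k))"
proof -
  let ?g = "gam (Suc k)" and ?e = "eps (Suc k)" and ?T = "total (Suc k)"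
  have 1: "2 * ?T * (gap (Suc k) + ?g / 2 * (norm (sE (Suc k) - sbar))\<^sup>2)
     \<le> 2 * ?T * (gap k + ?e\<^sup>2 / (2 * ?g))"
    using gap_descent total_nonneg[of "Suc k"] by (intro mult_left_mono) auto
  \<comment> \<open>One factor \<open>?e\<close> is bounded by \<open>eps_sum\<close>; the rest
    pairs the error of step \<open>k\<close> with the penalty of step \<open>Suc k\<close>, as in
    A4.\<close>
  have "?e * (?e / ?g * ?T) \<le> eps_sum * (?e / ?g * ?T)"
    using eps_le[of k] eps_nonneg[of k] gam_pos[of "Suc k"] total_nonneg[of "Suc k"]
    by (intro mult_right_mono mult_nonneg_nonneg divide_nonneg_pos) auto
  then have 2: "2 * ?T * (?e\<^sup>2 / (2 * ?g)) \<le> eps_sum * (?e / ?g * ?T)"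
    by (simp add: power2_eq_square mult_ac)
  show ?thesis
    using 1 2 fejer[of "Suc k"] norm2_drift_Suc_le[of "Suc k"]
    by (simp add: potential_def excess_eq total_Suc[of "Suc k"] power2_eq_square algebra_simps)
qed

lemma potential_bounded: "\<exists>c. \<forall>k. potential k \<le> c"
proof -
  let ?a = "\<lambda>k. eps (Suc k) / gam (Suc k) * total (Suc k)"
  define R where "R = 2 * radius + eps_sum"
  have R: "R \<ge> 0"
    using radius_nonneg eps_sum_nonneg by (simp add: R_def)
  have step: "potential k \<le> (norm (drift 0))\<^sup>2 + R * (\<Sum>j<Suc k. eps (Suc j))
      + eps_sum * (\<Sum>j<k. ?a j)" for k
  proof (induction k)
    case 0
    show ?case using potential_0 by (simp add: R_def mult_ac)
  next
    case (Suc k)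
    show ?case using Suc potential_Suc[of k] by (simp add: R_def algebra_simps)
  qed
  have a: "summable ?a" "\<And>k. ?a k \<ge> 0"
    using A4 eps_nonneg gam_pos total_nonneg
    by (auto simp only: total_def intro!: mult_nonneg_nonneg divide_nonneg_pos)
  have "potential k \<le> (norm (drift 0))\<^sup>2 + R * eps_sum + eps_sum * suminf ?a" for k
  proof -
    have "R * (\<Sum>j<Suc k. eps (Suc j)) \<le> R * eps_sum"
      using R eps_sum_partial by (intro mult_left_mono)
    moreover have "eps_sum * (\<Sum>j<k. ?a j) \<le> eps_sum * suminf ?a"
      using a eps_sum_nonneg by (intro mult_left_mono sum_le_suminf) auto
    ultimately show ?thesis using step[of k] by linarith
  qed
  then show ?thesis by blast
qed

section \<open>Rate of the squared violation for the exact steps\<close>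

lemma weighted_excess_bounded: "\<exists>c. \<forall>k. (\<Sum>j\<le>k. gam j * excess j) \<le> c"
proof -
  obtain c where c: "\<And>k. potential k \<le> c"
    using potential_bounded by blast
  have "(\<Sum>j\<le>k. gam j * excess j) \<le> c / gam 0" for k
  proof -
    have "gam 0 * (\<Sum>j\<le>k. gam j * excess j) \<le> (\<Sum>j\<le>k. gam j * total (Suc j) * excess j)"
      unfolding sum_distrib_left
    proof (rule sum_mono)
      fix j
      have "gam 0 * (gam j * excess j) \<le> total (Suc j) * (gam j * excess j)"
        using total_Suc_ge excess_nonneg[of j] gam_pos[of j] by (intro mult_right_mono) auto
      then show "gam 0 * (gam j * excess j) \<le> gam j * total (Suc j) * excess j"
        by (simp add: mult_ac)
    qed
    also have "\<dots> \<le> potential k"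
      using gap_nonneg[of k] total_nonneg[of "Suc k"] by (simp add: potential_def)
    also note c[of k]
    finally show ?thesis
      using gam_pos[of 0] by (simp add: field_simps)
  qed
  then show ?thesis by blast
qed

text \<open>Adding the subgradient inequalities of two successive exact steps gives monotonicity,
  perturbed by a multiplier error linear in the distance of their violations.\<close>

lemma excess_Suc_le: "excess (Suc k) \<le> excess k + (eps (Suc k) / gam (Suc k))\<^sup>2"
proof -
  let ?D = "sE (Suc k) - sE k" and ?g = "gam (Suc k)" and ?e = "eps (Suc k)"
  have "inner (lE k - lE (Suc k)) ?D \<le> 0"
    using exact_var[OF exact_mem, of k "Suc k"] exact_var[OF exact_mem, of "Suc k" k]
    by (simp add: inner_diff_left inner_diff_right algebra_simps)
  then have "?g * inner (sE (Suc k)) ?D \<le> inner (lam (Suc k) - lE k) ?D"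
    unfolding lE_diff by (simp add: inner_diff_left)
  also have "\<dots> \<le> ?e * norm ?D"
    using norm_cauchy_schwarz[of "lam (Suc k) - lE k" ?D] multiplier_error[of k]
    by (meson mult_right_mono norm_ge_zero order_trans)
  finally have "inner (sE (Suc k)) ?D \<le> ?e / ?g * norm ?D"
    using gam_pos[of "Suc k"] by (simp add: field_simps)
  moreover have "(norm (sE (Suc k)))\<^sup>2 = (norm (sE k))\<^sup>2 + 2 * inner (sE (Suc k)) ?D - (norm ?D)\<^sup>2"
    unfolding power2_norm_eq_inner by (simp add: inner_diff_left inner_diff_right inner_commute)
  \<comment> \<open>Completing the square: the term \<open>- (norm ?D)\<^sup>2\<close> of the
    identity above absorbs the linear error and leaves its squared coefficient.\<close>
  moreover have "0 \<le> (norm ?D - ?e / ?g)\<^sup>2"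
    by simp
  then have "2 * (?e / ?g * norm ?D) \<le> (norm ?D)\<^sup>2 + (?e / ?g)\<^sup>2"
    by (simp only: power2_diff) (simp add: mult_ac)
  ultimately show ?thesis
    by (simp add: excess_def)
qed

text \<open>Up to errors summed by A3, \<open>excess\<close> decreases, so its last value times the
  total weight is at most the weighted sum of all values.\<close>

lemma excess_rate: "\<exists>c. \<forall>k. total (Suc k) * excess k \<le> c"
proof -
  let ?a = "\<lambda>k. (eps (Suc k) / gam (Suc k))\<^sup>2 * total (Suc k)"
  obtain c where c: "\<And>k. (\<Sum>j\<le>k. gam j * excess j) \<le> c"
    using weighted_excess_bounded by blast
  have a: "summable ?a" "\<And>k. ?a k \<ge> 0"
    using A3 total_nonneg by (auto simp only: total_def intro!: mult_nonneg_nonneg zero_le_power2)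
  have partial: "total (Suc k) * excess k \<le> (\<Sum>j\<le>k. gam j * excess j) + (\<Sum>j<k. ?a j)" for k
  proof (induction k)
    case (Suc k)
    have "total (Suc k) * excess (Suc k)
        \<le> total (Suc k) * (excess k + (eps (Suc k) / gam (Suc k))\<^sup>2)"
      using excess_Suc_le total_nonneg by (intro mult_left_mono)
    then show ?case
      using Suc by (simp add: total_Suc[of "Suc k"] algebra_simps)
  qed (simp add: total_def)
  have "(\<Sum>j<k. ?a j) \<le> suminf ?a" for k
    using a by (intro sum_le_suminf) auto
  then have "total (Suc k) * excess k \<le> c + suminf ?a" for k
    by (rule order_trans[OF partial add_mono[OF c]])
  then show ?thesis by blast
qed

lemma exact_norm_bounded: "\<exists>c. \<forall>k. norm (sE k) \<le> c"
proof -
  obtain c where c: "\<And>k. total (Suc k) * excess k \<le> c"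
    using excess_rate by blast
  have "norm (sE k) \<le> sqrt ((norm sbar)\<^sup>2 + c / gam 0)" for k
  proof (rule real_le_rsqrt)
    have "gam 0 * excess k \<le> total (Suc k) * excess k"
      using total_Suc_ge excess_nonneg by (rule mult_right_mono)
    also note c[of k]
    finally show "(norm (sE k))\<^sup>2 \<le> (norm sbar)\<^sup>2 + c / gam 0"
      using gam_pos[of 0] by (simp add: excess_def field_simps)
  qed
  then show ?thesis by blast
qed

section \<open>Transfer of the rates to the inexact iterates\<close>

lemma step_error_rate: "norm (s (Suc k) - sE k) \<le> c2 / (total (Suc k) * sqrt (total (Suc k)))"
proof -
  have "eps (Suc k) / gam k \<le> c2 / (total (Suc k) * sqrt (total (Suc k)))"
    using divide_right_mono[OF A2[of k, folded total_def], of "total (Suc k)"] total_Suc_pos[of k]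
    by (simp add: mult.commute)
  then show ?thesis
    using step_error[of k] by linarith
qed

lemma violation_rate:
  "\<exists>c. \<forall>k. (norm (s (Suc k)))\<^sup>2 - (norm sbar)\<^sup>2 \<le> c / total (Suc k)"
proof -
  obtain c where c: "\<And>k. total (Suc k) * excess k \<le> c"
    using excess_rate by blast
  obtain b where b: "\<And>k. norm (sE k) \<le> b"
    using exact_norm_bounded by blast
  \<comment> \<open>Chosen so that \<open>c2 / (T * sqrt T)\<close> is at most \<open>d / T\<close>
    for each total \<open>T\<close>, since \<open>T\<close> is at least
    \<open>gam 0\<close>.\<close>
  define d where "d = c2 / sqrt (gam 0)"
  have c2: "0 \<le> c2"
  proof -
    have "0 \<le> c2 / (total (Suc 0) * sqrt (total (Suc 0)))"
      using step_error_rate[of 0] norm_ge_zero order_trans by blast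
    moreover have "0 < total (Suc 0) * sqrt (total (Suc 0))"
      using total_Suc_pos[of 0] by simp
    ultimately show ?thesis
      by (metis divide_neg_pos not_le)
  qed
  have d: "0 \<le> d"
    using c2 gam_pos[of 0] by (simp add: d_def)
  have "(norm (s (Suc k)))\<^sup>2 - (norm sbar)\<^sup>2 \<le> (c + d * (2 * b + d / gam 0)) / total (Suc k)" for k
  proof -
    let ?T = "total (Suc k)" and ?r = "norm (s (Suc k) - sE k)"
    have T: "?T > 0" by (rule total_Suc_pos)
    have r: "?r \<le> d / ?T"
    proof -
      have "c2 / sqrt ?T \<le> d"
        unfolding d_def using c2 total_Suc_ge gam_pos[of 0] T by (intro divide_left_mono) auto
      then have "c2 / sqrt ?T / ?T \<le> d / ?T"
        using T by (intro divide_right_mono) auto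
      then show ?thesis
        using step_error_rate[of k] by (simp add: mult.commute)
    qed
    also have "\<dots> \<le> d / gam 0"
      using d total_Suc_ge gam_pos[of 0] T by (intro divide_left_mono) auto
    finally have r0: "?r \<le> d / gam 0" .
    have "norm (s (Suc k)) \<le> norm (sE k) + ?r"
      by (rule norm_triangle_sub)
    then have "(norm (s (Suc k)))\<^sup>2 \<le> (norm (sE k) + ?r)\<^sup>2"
      by (intro power_mono) auto
    also have "\<dots> = (norm (sE k))\<^sup>2 + ?r * (2 * norm (sE k) + ?r)"
      by (simp add: power2_eq_square algebra_simps)
    also have "\<dots> \<le> (norm (sE k))\<^sup>2 + d / ?T * (2 * b + d / gam 0)"
      using r r0 b[of k] d T by (intro add_left_mono mult_mono) auto
    finally have "(norm (s (Suc k)))\<^sup>2 - (norm sbar)\<^sup>2 \<le> excess k + d / ?T * (2 * b + d / gam 0)"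
      by (simp add: excess_def)
    moreover have "excess k \<le> c / ?T"
      using c[of k] T by (simp add: field_simps)
    ultimately show ?thesis
      by (simp add: add_divide_distrib)
  qed
  then show ?thesis by blast
qed

lemma deviation_sq_le: "(norm (s (Suc k) - sbar))\<^sup>2 \<le> (norm (s (Suc k)))\<^sup>2 - (norm sbar)\<^sup>2"
  using norm2_diff_eq[of "s (Suc k)"] least_violation[OF step_mem, of k] by simp

lemma deviation_rate: "\<exists>c\<ge>0. \<forall>k. norm (s (Suc k) - sbar) \<le> c / sqrt (total (Suc k))"
proof -
  obtain c where c: "\<And>k. (norm (s (Suc k)))\<^sup>2 - (norm sbar)\<^sup>2 \<le> c / total (Suc k)"
    using violation_rate by blast
  have "0 \<le> c / total (Suc 0)"
    using c[of 0] deviation_sq_le[of 0] by (smt (verit) zero_le_power2)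
  then have "0 \<le> c"
    using total_Suc_pos[of 0] by (simp add: zero_le_divide_iff)
  moreover have "norm (s (Suc k) - sbar) \<le> sqrt c / sqrt (total (Suc k))" for k
    using c[of k] deviation_sq_le[of k] by (simp add: real_le_rsqrt flip: real_sqrt_divide)
  ultimately show ?thesis by (intro exI[of _ "sqrt c"]) auto
qed

text \<open>Comparing the step with \<open>(sbar, nubar)\<close> puts the multiplier
  \<open>lam k - gam k *\<^sub>R sbar\<close> in front of the deviation. Its only possibly unbounded
  part, \<open>- total (Suc k) *\<^sub>R sbar\<close>, has a favorable sign by
  \<open>least_violation\<close>.\<close>

lemma objective_upper:
  "v (Suc k) - nubar \<le> (radius + norm lbar) * norm (s (Suc k) - sbar)
     + eps_sum * (eps (Suc k) / gam k)"
proof -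
  let ?S = "s (Suc k) - sbar" and ?g = "gam k"
  have eq: "lam k - ?g *\<^sub>R sbar = drift k + lbar - total (Suc k) *\<^sub>R sbar"
    by (simp add: drift_def total_Suc algebra_simps)
  have "v (Suc k) - nubar - inner (lam k - ?g *\<^sub>R sbar) ?S + ?g / 2 * (norm ?S)\<^sup>2
      \<le> (eps (Suc k))\<^sup>2 / (2 * ?g)"
    using step_opt_closure[OF target, of k]
      quad_pert_expand[of "lam k" ?g "s (Suc k)" "v (Suc k)" sbar nubar] by linarith
  moreover have "inner (lam k - ?g *\<^sub>R sbar) ?S
      = inner (drift k + lbar) ?S - total (Suc k) * inner sbar ?S"
    unfolding eq by (simp add: inner_diff_left)
  moreover have "0 \<le> total (Suc k) * inner sbar ?S"
    using total_nonneg least_violation[OF step_mem] by (intro mult_nonneg_nonneg)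
  moreover have "0 \<le> ?g / 2 * (norm ?S)\<^sup>2"
    using gam_pos[of k] by simp
  moreover have "inner (drift k + lbar) ?S \<le> (radius + norm lbar) * norm ?S"
  proof -
    have "norm (drift k + lbar) \<le> radius + norm lbar"
      using norm_drift_le[of k] norm_triangle_ineq[of "drift k" lbar] by linarith
    then show ?thesis
      by (meson mult_right_mono norm_cauchy_schwarz norm_ge_zero order_trans)
  qed
  moreover have "(eps (Suc k))\<^sup>2 / (2 * ?g) \<le> eps_sum * (eps (Suc k) / ?g)"
  proof -
    have "eps (Suc k) * (eps (Suc k) / ?g) \<le> eps_sum * (eps (Suc k) / ?g)"
      using eps_le[of k] eps_nonneg[of k] gam_pos[of k] by (intro mult_right_mono) auto
    moreover have "0 \<le> (eps (Suc k))\<^sup>2 / ?g"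
      using gam_pos[of k] by simp
    ultimately show ?thesis by (simp add: power2_eq_square)
  qed
  ultimately show ?thesis by linarith
qed

text \<open>The lower bound is the subgradient inequality for \<open>lbar\<close>, the upper one
  \<open>objective_upper\<close>; both are linear in the deviation, up to an error controlled by
  A2.\<close>

lemma objective_rate: "\<exists>c. \<forall>k. \<bar>v (Suc k) - nubar\<bar> \<le> c / sqrt (total (Suc k))"
proof -
  obtain c where c: "\<And>k. norm (s (Suc k) - sbar) \<le> c / sqrt (total (Suc k))"
    using deviation_rate by blast
  have "\<bar>v (Suc k) - nubar\<bar>
      \<le> ((radius + norm lbar) * c + eps_sum * (c2 / gam 0)) / sqrt (total (Suc k))" for k
  proof -
    let ?T = "total (Suc k)" and ?S = "s (Suc k) - sbar"
    have T: "?T > 0" by (rule total_Suc_pos)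
    have err: "eps (Suc k) / gam k \<le> c2 / gam 0 / sqrt ?T"
    proof -
      have "eps (Suc k) / gam k * gam 0 \<le> eps (Suc k) / gam k * ?T"
        using total_Suc_ge eps_nonneg[of k] gam_pos[of k] by (intro mult_left_mono) auto
      also have "\<dots> \<le> c2 / sqrt ?T"
        using A2[of k] by (simp add: total_def)
      finally have "eps (Suc k) / gam k \<le> c2 / sqrt ?T / gam 0"
        using gam_pos[of 0] by (simp only: pos_le_divide_eq)
      then show ?thesis
        by (simp add: mult.commute)
    qed
    have "(radius + norm lbar) * norm ?S \<le> (radius + norm lbar) * (c / sqrt ?T)"
      using c radius_nonneg by (intro mult_left_mono) auto
    moreover have "norm lbar * norm ?S \<le> (radius + norm lbar) * norm ?S"
      using radius_nonneg by (intro mult_right_mono) auto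
    moreover have "eps_sum * (eps (Suc k) / gam k) \<le> eps_sum * (c2 / gam 0 / sqrt ?T)"
      using err eps_sum_nonneg by (intro mult_left_mono)
    moreover have "0 \<le> eps_sum * (eps (Suc k) / gam k)"
      using eps_sum_nonneg eps_nonneg[of k] gam_pos[of k] by simp
    moreover have "- (norm lbar * norm ?S) \<le> v (Suc k) - nubar"
      using subgradient[OF step_mem[of k]] Cauchy_Schwarz_ineq2[of lbar ?S] by linarith
    moreover note objective_upper[of k]
    ultimately have "\<bar>v (Suc k) - nubar\<bar>
        \<le> (radius + norm lbar) * (c / sqrt ?T) + eps_sum * (c2 / gam 0 / sqrt ?T)"
      by linarith
    then show ?thesis
      by (simp add: add_divide_distrib)
  qed
  then show ?thesis by blast
qed

end

section \<open>Asymptotic estimates along sequences\<close>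

text \<open>Positivity of \<open>b\<close> lets the finitely many initial ratios be added to the
  asymptotic constant.\<close>

lemma bigo_sequentially_uniform:
  fixes a b :: "nat \<Rightarrow> real"
  assumes "a \<in> O(b)" and pos: "\<And>n. b n > 0"
  obtains c where "\<And>n. a n \<le> c * b n"
proof -
  from assms(1) obtain d where "\<forall>\<^sub>F n in sequentially. norm (a n) \<le> d * norm (b n)"
    by (elim landau_o.bigE)
  then obtain N where N: "\<And>n. n \<ge> N \<Longrightarrow> norm (a n) \<le> d * norm (b n)"
    by (auto simp: eventually_sequentially)
  define S where "S = (\<Sum>n<N. \<bar>a n\<bar> / b n)"
  have nonneg: "\<bar>a n\<bar> / b n \<ge> 0" for n
    using pos[of n] by simp
  have "a n \<le> (\<bar>d\<bar> + S) * b n" for n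
  proof -
    have "\<bar>a n\<bar> / b n \<le> \<bar>d\<bar> + S"
    proof (cases "n < N")
      case True
      then have "\<bar>a n\<bar> / b n \<le> S"
        unfolding S_def using nonneg by (intro member_le_sum) auto
      then show ?thesis by simp
    next
      case False
      then have "\<bar>a n\<bar> / b n \<le> d"
        using N[of n] pos[of n] by (simp add: pos_divide_le_eq)
      moreover have "0 \<le> S"
        unfolding S_def using nonneg by (intro sum_nonneg)
      ultimately show ?thesis by linarith
    qed
    then have "\<bar>a n\<bar> \<le> (\<bar>d\<bar> + S) * b n"
      using pos[of n] by (simp add: pos_divide_le_eq)
    then show ?thesis by linarith
  qed
  then show ?thesis by (rule that)
qed

text \<open>Bounds are required from index 1 on: in the application the iterate at index 0 is
  arbitrary and \<open>T 0\<close> is 0.\<close>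

lemma inverse_sqrt_rate:
  fixes a T :: "nat \<Rightarrow> real"
  assumes T: "filterlim T at_top sequentially"
    and a: "\<And>k. 0 \<le> a k" "\<And>k. a (Suc k) \<le> c / sqrt (T (Suc k))"
  shows "a \<in> O(\<lambda>k. 1 / sqrt (T k))" and "a \<longlonglongrightarrow> 0"
proof -
  have "\<forall>\<^sub>F k in sequentially. a (Suc k) \<le> c * norm (1 / sqrt (T (Suc k)))"
    using filterlim_compose[OF T filterlim_Suc, THEN eventually_gt_at_top[of 0, THEN eventually_compose_filterlim]]
  proof eventually_elim
    case (elim k)
    then show ?case using a(2)[of k] by simp
  qed
  then have "\<forall>\<^sub>F k in sequentially. a k \<le> c * norm (1 / sqrt (T k))"
    by (rule eventually_sequentially_Suc[THEN iffD1])
  then have ev: "\<forall>\<^sub>F k in sequentially. norm (a k) \<le> c * norm (1 / sqrt (T k))"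
    using a(1) by simp
  then show "a \<in> O(\<lambda>k. 1 / sqrt (T k))"
    by (rule bigoI)
  have "filterlim (\<lambda>k. sqrt (T k)) at_top sequentially"
    using sqrt_at_top T by (rule filterlim_compose)
  then have "(\<lambda>k. 1 / sqrt (T k)) \<longlonglongrightarrow> 0"
    by (intro tendsto_divide_0[OF tendsto_const] filterlim_at_top_imp_at_infinity)
  then have "(\<lambda>k. c * norm (1 / sqrt (T k))) \<longlonglongrightarrow> 0"
    by (rule tendsto_mult_right_zero[OF tendsto_norm_zero])
  then show "a \<longlonglongrightarrow> 0"
    by (rule Lim_null_comparison[OF ev])
qed

section \<open>Reduction of the constrained problem\<close>

text \<open>
  In terms of pairs of a violation and an upper bound for the objective, the method no longer
  refers to \<open>X\<close>, \<open>C\<close> and \<open>K\<close>, and all values are real. The set need not be closed, so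
  exact minimizers are taken in its closure.
\<close>

definition violation_epigraph ::
  "'a set \<Rightarrow> ('a \<Rightarrow> ereal) \<Rightarrow> ('a \<Rightarrow> 'b::real_normed_vector) \<Rightarrow> 'b set \<Rightarrow> ('b \<times> real) set" where
  "violation_epigraph X f C K =
    {(t, w). \<exists>x. (x, t) \<in> constraint_graph X C K \<and> f x \<le> ereal w}"

lemma mem_constraint_graph: "(x, t) \<in> constraint_graph X C K \<longleftrightarrow> x \<in> X \<and> C x - t \<in> K"
  by (force simp: constraint_graph_def)

lemma value_fun_eq: "value_fun X f C K t = (INF x\<in>{x. (x, t) \<in> constraint_graph X C K}. f x)"
proof -
  have "C x \<in> t +o K \<longleftrightarrow> C x - t \<in> K" for x
    by (force simp: elt_set_plus_def)
  then show ?thesis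
    by (simp add: value_fun_def mem_constraint_graph)
qed

lemma attainable_violations_eq: "attainable_violations X f C K = fst ` violation_epigraph X f C K"
proof (intro equalityI subsetI)
  fix t assume "t \<in> attainable_violations X f C K"
  then obtain x where x: "f x < \<infinity>" "(x, t) \<in> constraint_graph X C K"
    by (auto simp: attainable_violations_def)
  then obtain w where "f x \<le> ereal w"
    by (cases "f x") auto
  then have "(t, w) \<in> violation_epigraph X f C K"
    using x by (auto simp: violation_epigraph_def)
  then show "t \<in> fst ` violation_epigraph X f C K"
    by force
qed (force simp: attainable_violations_def violation_epigraph_def mem_constraint_graph
    intro: le_less_trans)

lemma convex_violation_epigraph:
  assumes f: "ereal_convex_on X f" and graph: "convex (constraint_graph X C K)"
  shows "convex (violation_epigraph X f C K)"
proof (rule convexI)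
  fix z z' :: "'b \<times> real" and u v :: real
  assume z: "z \<in> violation_epigraph X f C K" "z' \<in> violation_epigraph X f C K"
    and uv: "0 \<le> u" "0 \<le> v" "u + v = 1"
  obtain t w t' w' x x' where eq: "z = (t, w)" "z' = (t', w')"
    and x: "(x, t) \<in> constraint_graph X C K" "f x \<le> ereal w"
    and x': "(x', t') \<in> constraint_graph X C K" "f x' \<le> ereal w'"
    using z by (auto simp: violation_epigraph_def)
  have "f (u *\<^sub>R x + v *\<^sub>R x') \<le> ereal u * f x + ereal v * f x'"
    using f x(1) x'(1) uv by (auto simp: ereal_convex_on_def mem_constraint_graph)
  also have "\<dots> \<le> ereal u * ereal w + ereal v * ereal w'"
    using x(2) x'(2) uv by (intro add_mono ereal_mult_left_mono) auto
  finally have "f (u *\<^sub>R x + v *\<^sub>R x') \<le> ereal (u * w + v * w')"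
    by simp
  moreover have "u *\<^sub>R (x, t) + v *\<^sub>R (x', t') \<in> constraint_graph X C K"
    using graph x(1) x'(1) uv by (rule convexD)
  ultimately show "u *\<^sub>R z + v *\<^sub>R z' \<in> violation_epigraph X f C K"
    by (auto simp: violation_epigraph_def eq)
qed

text \<open>The infimum may not be attained, but every level strictly above it belongs to the
  epigraph.\<close>

lemma value_fun_in_closure:
  assumes "value_fun X f C K t = ereal r"
  shows "(t, r) \<in> closure (violation_epigraph X f C K)"
proof -
  have "(t, r + inverse (real (Suc n))) \<in> violation_epigraph X f C K" for n
  proof -
    have "value_fun X f C K t < ereal (r + inverse (real (Suc n)))"
      unfolding assms by simp
    then show ?thesis
      by (auto simp: value_fun_eq violation_epigraph_def INF_less_iff intro: less_imp_le)
  qed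
  moreover have "(\<lambda>n. (t, r + inverse (real (Suc n)))) \<longlonglongrightarrow> (t, r)"
    using tendsto_Pair[OF tendsto_const tendsto_add[OF tendsto_const LIMSEQ_inverse_real_of_nat]]
    by simp
  ultimately show ?thesis
    unfolding closure_sequential
    by (intro exI[of _ "\<lambda>n. (t, r + inverse (real (Suc n)))"] conjI allI)
qed

lemma value_fun_le:
  assumes "(t, w) \<in> violation_epigraph X f C K"
  shows "value_fun X f C K t \<le> ereal w"
  using assms by (auto simp: value_fun_eq violation_epigraph_def intro: INF_lower2)

text \<open>The element of least norm is the projection of the origin, and the attainable violations
  are a linear image of a convex set, so the variational inequality of the projection
  applies.\<close>

lemma min_violation_least:
  fixes C :: "'a::real_vector \<Rightarrow> 'b::{real_inner, complete_space}"
  assumes "ereal_convex_on X f" "convex (constraint_graph X C K)"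
    and tw: "(t, w) \<in> violation_epigraph X f C K"
  shows "0 \<le> inner (min_violation X f C K) (t - min_violation X f C K)"
proof -
  let ?S = "closure (attainable_violations X f C K)"
  have "convex ?S"
    unfolding attainable_violations_eq
    by (intro convex_closure convex_linear_image[OF linear_fst] convex_violation_epigraph assms)
  moreover have t: "t \<in> ?S"
    unfolding attainable_violations_eq using tw closure_subset by force
  moreover have "min_violation X f C K = arg_min_on (\<lambda>a. norm (0 - a)) ?S"
    by (simp add: min_violation_def)
  ultimately show ?thesis
    using arg_min_dist(2)[of ?S t 0] by (metis closed_closure diff_0 empty_iff inner_minus_left
        neg_le_0_iff_le)
qed

text \<open>Replacing \<open>y\<close> by the projection gives an attainable violation, hence one no
  shorter than \<open>sbar\<close>; the obtuse angle at the projection supplies a Pythagorean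
  inequality.\<close>

lemma metric_proj_estimate:
  fixes C :: "'a \<Rightarrow> 'b::{real_inner, complete_space}"
  assumes K: "K \<noteq> {}" "closed K" "convex K"
    and x: "x \<in> X" "f x \<le> ereal w" and y: "y \<in> K"
    and least: "\<And>t w. (t, w) \<in> violation_epigraph X f C K \<Longrightarrow> 0 \<le> inner sbar (t - sbar)"
  shows "(norm (y - metric_proj K (C x)))\<^sup>2 \<le> (norm (C x - y))\<^sup>2 - (norm sbar)\<^sup>2"
proof -
  define p where "p = metric_proj K (C x)"
  have p: "p \<in> K" "inner (C x - p) (y - p) \<le> 0"
    using arg_min_dist(1)[OF K(2,3,1), of "C x"] arg_min_dist(2)[OF K(2,3,1) y, of "C x"]
    by (simp_all add: p_def metric_proj_def)
  then have "(C x - p, w) \<in> violation_epigraph X f C K"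
    using x by (auto simp: violation_epigraph_def mem_constraint_graph)
  then have least_p: "0 \<le> inner sbar (C x - p - sbar)"
    by (rule least)
  have "(norm (C x - p))\<^sup>2 = (norm sbar)\<^sup>2 + 2 * inner sbar (C x - p - sbar)
      + (norm (C x - p - sbar))\<^sup>2"
    unfolding power2_norm_eq_inner by (simp add: inner_diff_left inner_diff_right inner_commute)
  then have "(norm sbar)\<^sup>2 \<le> (norm (C x - p))\<^sup>2"
    using least_p zero_le_power2[of "norm (C x - p - sbar)"] by linarith
  moreover have "(norm (C x - y))\<^sup>2 = (norm (C x - p))\<^sup>2 - 2 * inner (C x - p) (y - p)
      + (norm (y - p))\<^sup>2"
    unfolding power2_norm_eq_inner by (simp add: inner_diff_left inner_diff_right inner_commute)
  ultimately show ?thesis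
    using p(2) unfolding p_def[symmetric] by linarith
qed

lemma ialm_step:
  assumes alg: "ialm X f C K gam eps x y lam s" and f: "proper_on X f"
  shows "f (x (Suc k)) = ereal (real_of_ereal (f (x (Suc k))))"
    and "z \<in> violation_epigraph X f C K \<Longrightarrow>
      quad_pert (lam k) (gam k) (s (Suc k), real_of_ereal (f (x (Suc k))))
        \<le> quad_pert (lam k) (gam k) z + (eps (Suc k))\<^sup>2 / (2 * gam k)"
proof -
  let ?r = "(eps (Suc k))\<^sup>2 / (2 * gam k)"
  define L where "L = aug_lagrangian f (gam k) (x (Suc k)) (s (Suc k)) (lam k)"
  define I where "I = (INF (x', s')\<in>constraint_graph X C K. aug_lagrangian f (gam k) x' s' (lam k))"
  have L_I: "L - I \<le> ereal ?r" and xX: "x (Suc k) \<in> X"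
    using alg unfolding ialm_def L_def I_def by blast+
  have "(x (Suc k), s (Suc k)) \<in> constraint_graph X C K"
    using alg by (simp add: ialm_def mem_constraint_graph)
  then have "I \<le> L"
    unfolding I_def L_def by (force intro: INF_lower2)
  have "f (x (Suc k)) \<noteq> -\<infinity>"
    using f xX by (auto simp: proper_on_def)
  \<comment> \<open>An infinite objective value or an infimum \<open>-\<infinity>\<close> would make
    the difference \<open>\<infinity>\<close>; an infimum \<open>\<infinity>\<close> is excluded by
    \<open>I \<le> L\<close>.\<close>
  then obtain v i where v: "f (x (Suc k)) = ereal v" and i: "I = ereal i"
    using L_I \<open>I \<le> L\<close> unfolding L_def aug_lagrangian_def
    by (cases "f (x (Suc k))"; cases I) auto
  show "f (x (Suc k)) = ereal (real_of_ereal (f (x (Suc k))))"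
    by (simp add: v)
  have L: "L = ereal (quad_pert (lam k) (gam k) (s (Suc k), v))"
    by (simp add: L_def aug_lagrangian_def v quad_pert_def)
  show "quad_pert (lam k) (gam k) (s (Suc k), real_of_ereal (f (x (Suc k))))
      \<le> quad_pert (lam k) (gam k) z + ?r" if z: "z \<in> violation_epigraph X f C K"
  proof -
    obtain t w x' where eq: "z = (t, w)"
      and x': "(x', t) \<in> constraint_graph X C K" "f x' \<le> ereal w"
      using z by (auto simp: violation_epigraph_def)
    have "I \<le> aug_lagrangian f (gam k) x' t (lam k)"
      unfolding I_def using x'(1) by (force intro: INF_lower2)
    also have "\<dots> \<le> ereal w - ereal (inner (lam k) t) + ereal (gam k / 2 * (norm t)\<^sup>2)"
      unfolding aug_lagrangian_def by (intro add_mono ereal_minus_mono x'(2)) auto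
    finally have "i \<le> quad_pert (lam k) (gam k) z"
      by (simp add: i eq quad_pert_def)
    then show ?thesis
      using L_I by (simp add: L i v)
  qed
qed

theorem theorem3p10:
  fixes X :: "'a::{real_inner, complete_space} set"
    and K :: "'b::{real_inner, complete_space} set"
    and f :: "'a \<Rightarrow> ereal"
    and C :: "'a \<Rightarrow> 'b"
    and gam eps :: "nat \<Rightarrow> real"
    and x :: "nat \<Rightarrow> 'a"
    and y lam s :: "nat \<Rightarrow> 'b"
  assumes X: "X \<noteq> {}" "closed X" "convex X"
    and K: "K \<noteq> {}" "closed K" "convex K"
    and f: "proper_on X f" "lsc_on X f" "ereal_convex_on X f"
    and graph: "closed (constraint_graph X C K)" "convex (constraint_graph X C K)"
    and value_gt: "\<And>t. value_fun X f C K t > -\<infinity>"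
    and conditions: "error_step_conditions gam eps"
    and algorithm: "ialm X f C K gam eps x y lam s"
    and subdiff: "subdifferentiable_at (value_fun X f C K) (min_violation X f C K)"
  shows "quant_conv_closest_feasible X f C K gam x y"
proof -
  define sbar where "sbar = min_violation X f C K"
  define G where "G = violation_epigraph X f C K"
  define v where "v = (\<lambda>k. real_of_ereal (f (x k)))"
  define T where "T = (\<lambda>k. \<Sum>i<k. gam i)"
  obtain nubar where nubar: "value_fun X f C K sbar = ereal nubar"
    using value_gt[of sbar] subdiff
    by (cases "value_fun X f C K sbar") (auto simp: subdifferentiable_at_def sbar_def)
  obtain lbar where lbar: "\<And>t. ereal nubar + ereal (inner lbar (t - sbar)) \<le> value_fun X f C K t"
    using subdiff unfolding subdifferentiable_at_def subdifferential_def
    by (auto simp: sbar_def[symmetric] nubar)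
  have least: "0 \<le> inner sbar (t - sbar)" if "(t, w) \<in> G" for t w
    using min_violation_least[OF f(3) graph(2)] that by (simp add: G_def sbar_def)
  have step: "x (Suc k) \<in> X" "y (Suc k) \<in> K" "s (Suc k) = C (x (Suc k)) - y (Suc k)"
    "lam (Suc k) = lam k - gam k *\<^sub>R s (Suc k)" for k
    using algorithm by (auto simp: ialm_def)
  have fv: "f (x (Suc k)) = ereal (v (Suc k))" for k
    using ialm_step(1)[OF algorithm f(1)] by (simp add: v_def)
  have gam: "gam k > 0" for k
    using conditions by (simp add: error_step_conditions_def)
  have sum1: "(\<Sum>i=0..k. gam i) = (\<Sum>i<Suc k. gam i)" for k
    by (simp only: atLeast0AtMost lessThan_Suc_atMost)
  have sum2: "(\<Sum>i=1..Suc k. gam (i - 1)) = (\<Sum>i<Suc k. gam i)" for k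
    using sum.atLeast_Suc_atMost_Suc_shift[of "\<lambda>i. gam (i - 1)" 0 k]
    by (simp only: atLeast0AtMost lessThan_Suc_atMost One_nat_def comp_def diff_Suc_Suc
        minus_nat.diff_0)
  have T_lim: "filterlim T at_top sequentially"
    and A1: "summable (\<lambda>k. eps (Suc k))"
    and A2': "(\<lambda>k. eps (Suc k) / gam k * T (Suc k)) \<in> O(\<lambda>k. 1 / sqrt (T (Suc k)))"
    and A3: "summable (\<lambda>k. (eps (Suc k) / gam (Suc k))\<^sup>2 * T (Suc k))"
    and A4: "summable (\<lambda>k. eps (Suc k) / gam (Suc k) * T (Suc k))"
    using conditions unfolding error_step_conditions_def T_def sum1 sum2 by blast+
  have T_pos: "T (Suc k) > 0" for k
    unfolding T_def using gam by (intro sum_pos) auto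
  obtain c2 where A2: "\<And>k. eps (Suc k) / gam k * T (Suc k) \<le> c2 * (1 / sqrt (T (Suc k)))"
    using bigo_sequentially_uniform[OF A2'] T_pos by auto
  interpret inexact_prox_iteration G sbar lbar nubar c2 gam eps lam s v
  proof
    show "convex G"
      unfolding G_def by (rule convex_violation_epigraph[OF f(3) graph(2)])
    show "(sbar, nubar) \<in> closure G"
      unfolding G_def using nubar by (rule value_fun_in_closure)
    show "nubar + inner lbar (t - sbar) \<le> w" if "(t, w) \<in> G" for t w
      using order_trans[OF lbar value_fun_le[OF that[unfolded G_def]]] by simp
    show "(s (Suc k), v (Suc k)) \<in> G" for k
      using step[of k] fv[of k] by (auto simp: G_def violation_epigraph_def mem_constraint_graph)
    show "quad_pert (lam k) (gam k) (s (Suc k), v (Suc k))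
        \<le> quad_pert (lam k) (gam k) z + (eps (Suc k))\<^sup>2 / (2 * gam k)" if "z \<in> G" for k z
      using ialm_step(2)[OF algorithm f(1)] that by (simp add: G_def v_def)
    show "eps (Suc k) \<ge> 0" for k
      using conditions by (simp add: error_step_conditions_def)
    show "eps (Suc k) / gam k * (\<Sum>i<Suc k. gam i) \<le> c2 / sqrt (\<Sum>i<Suc k. gam i)" for k
      using A2[of k] by (simp add: T_def)
  qed (use least gam step A1 A3 A4 in \<open>simp_all only: T_def\<close>)
  have total: "total = T"
    by (simp add: total_def T_def fun_eq_iff)
  obtain c where c: "\<And>k. (norm (s (Suc k)))\<^sup>2 - (norm sbar)\<^sup>2 \<le> c / T (Suc k)"
    using violation_rate total by auto
  have proj: "norm (y (Suc k) - metric_proj K (C (x (Suc k)))) \<le> sqrt c / sqrt (T (Suc k))" for k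
  proof -
    have "(norm (y (Suc k) - metric_proj K (C (x (Suc k)))))\<^sup>2
        \<le> (norm (s (Suc k)))\<^sup>2 - (norm sbar)\<^sup>2"
      unfolding step(3) using step(1,2)[of k] least
      by (intro metric_proj_estimate[OF K, of _ X f "v (Suc k)"]) (auto simp: fv G_def)
    then show ?thesis
      using c[of k] by (simp add: real_le_rsqrt flip: real_sqrt_divide)
  qed
  obtain d where d: "\<And>k. norm (s (Suc k) - sbar) \<le> d / sqrt (T (Suc k))"
    using deviation_rate total by auto
  then have dev: "norm (C (x (Suc k)) - y (Suc k) - sbar) \<le> d / sqrt (T (Suc k))" for k
    by (simp only: step(3)[symmetric])
  obtain e where e: "\<And>k. \<bar>v (Suc k) - nubar\<bar> \<le> e / sqrt (T (Suc k))"
    using objective_rate total by auto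
  have "v \<longlonglongrightarrow> nubar"
    using inverse_sqrt_rate(2)[OF T_lim _ e] by (simp add: tendsto_rabs_zero_iff LIM_zero_iff)
  \<comment> \<open>The value \<open>v 0\<close> may misrepresent an infinite
    \<open>f (x 0)\<close>, so the limit is passed through the shifted sequence.\<close>
  then have "(\<lambda>k. f (x (Suc k))) \<longlonglongrightarrow> ereal nubar"
    unfolding fv using LIMSEQ_Suc by auto
  then have f_lim: "(\<lambda>k. f (x k)) \<longlonglongrightarrow> ereal nubar"
    by (rule LIMSEQ_imp_Suc)
  have "\<bar>f (x (Suc k)) - ereal nubar\<bar> \<le> ereal (e * (1 / sqrt (T (Suc k))))" for k
    using e[of k] by (simp add: fv)
  then have f_rate: "\<forall>\<^sub>F k in sequentially. \<bar>f (x k) - ereal nubar\<bar> \<le> ereal (e * (1 / sqrt (T k)))"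
    by (subst eventually_sequentially_Suc[symmetric]) simp
  have "(\<lambda>k. C (x k) - y k) \<longlonglongrightarrow> sbar"
    using inverse_sqrt_rate(2)[OF T_lim _ dev] by (simp add: tendsto_norm_zero_iff LIM_zero_iff)
  then show ?thesis
    using f_lim f_rate inverse_sqrt_rate[OF T_lim _ proj] inverse_sqrt_rate(1)[OF T_lim _ dev]
    unfolding quant_conv_closest_feasible_def Let_def sbar_def[symmetric] nubar T_def
    by auto
qed

end
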